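(* Let $X$ be a strongly zero-dimensional space and $Y$ be a metrizable space. Then $\mathrm{K}_1(X,Y)\cap\Sigma^f(X,Y)=\mathrm{B}_1(X,Y)$.
   Context: Zero sets of a topological space $X$ are sets of the form $g^{-1}(0)$ with $g:X\to[0,1]$ continuous; cozero sets are their complements. A subset of $X$ is functionally $F_\sigma$ if it is a union of a sequence of zero sets. Subsets $A,B$ of $X$ are completely separated if there is a continuous $g:X\to[0,1]$ with $A\subseteq g^{-1}(0)$ and $B\subseteq g^{-1}(1)$. A topological space $X$ is strongly zero-dimensional if for any completely separated subsets $A$ and $B$ of $X$ there exists a clopen set $U$ with $A\subseteq U\subseteq X\setminus B$ (no separation axiom is included). For topological spaces $X,Y$: $\mathrm{B}_1(X,Y)$ is the set of mappings $f:X\to Y$ that are pointwise limits of a sequence of continuous mappings $X\to Y$; $\mathrm{K}_1(X,Y)$ is the set of mappings $f:X\to Y$ such that $f^{-1}(V)$ is functionally $F_\sigma$ in $X$ for every open $V\subseteq Y$. A family $(A_i:i\in I)$ of subsets of $X$ is discrete if every point of $X$ has a neighborhood which intersects at most one set from the family (i.e. $A_i$ for at most one index $i$). It is strongly functionally discrete (an sfd-family) if there exists a discrete family $(U_i:i\in I)$ of cozero subsets of $X$ such that $\overline{A_i}\subseteq U_i$ for every $i\in I$. A family is $\sigma$-sfd if it is a union of a sequence of sfd-families. A family $\mathcal B$ of subsets of $X$ is a base for a mapping $f:X\to Y$ if for every open $V\subseteq Y$ the preimage $f^{-1}(V)$ is a union of sets from $\mathcal B$. $\Sigma^f(X,Y)$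 is the set of all mappings $f:X\to Y$ having a base which is a $\sigma$-sfd family. *)

theory Defs
  imports "HOL-Analysis.Analysis"
begin

text \<open>Spaces are abstract topologies, so subsets of \<open>X\<close> and preimages are explicitly relativised
  to \<open>topspace X\<close>. As with \<^const>\<open>continuous_map\<close>, a mapping \<open>X \<rightarrow> Y\<close> is a HOL function sending
  \<open>topspace X\<close> into \<open>topspace Y\<close>; its values off \<open>topspace X\<close> are unconstrained.\<close>

definition zero_set :: "'a topology \<Rightarrow> 'a set \<Rightarrow> bool" where
  "zero_set X Z \<longleftrightarrow>
    (\<exists>g. continuous_map X (top_of_set {0..1::real}) g \<and> Z = {x \<in> topspace X. g x = 0})"

definition cozero_set :: "'a topology \<Rightarrow> 'a set \<Rightarrow> bool" where
  "cozero_set X U \<longleftrightarrow> (\<exists>Z. zero_set X Z \<and> U = topspace X - Z)"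

definition functionally_F_sigma :: "'a topology \<Rightarrow> 'a set \<Rightarrow> bool" where
  "functionally_F_sigma X A \<longleftrightarrow> (\<exists>Z :: nat \<Rightarrow> 'a set. (\<forall>n. zero_set X (Z n)) \<and> A = (\<Union>n. Z n))"

definition completely_separated :: "'a topology \<Rightarrow> 'a set \<Rightarrow> 'a set \<Rightarrow> bool" where
  "completely_separated X A B \<longleftrightarrow>
    (\<exists>g. continuous_map X (top_of_set {0..1::real}) g \<and>
         A \<subseteq> {x \<in> topspace X. g x = 0} \<and> B \<subseteq> {x \<in> topspace X. g x = 1})"

definition strongly_zero_dimensional :: "'a topology \<Rightarrow> bool" where
  "strongly_zero_dimensional X \<longleftrightarrow>
    (\<forall>A B. completely_separated X A B \<longrightarrow>
      (\<exists>U. openin X U \<and> closedin X U \<and> A \<subseteq> U \<and> U \<subseteq> topspace X - B))"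

definition B1 :: "'a topology \<Rightarrow> 'b topology \<Rightarrow> ('a \<Rightarrow> 'b) set" where
  "B1 X Y = {f \<in> topspace X \<rightarrow> topspace Y.
    \<exists>F :: nat \<Rightarrow> 'a \<Rightarrow> 'b. (\<forall>n. continuous_map X Y (F n)) \<and>
      (\<forall>x \<in> topspace X. limitin Y (\<lambda>n. F n x) (f x) sequentially)}"

definition K1 :: "'a topology \<Rightarrow> 'b topology \<Rightarrow> ('a \<Rightarrow> 'b) set" where
  "K1 X Y = {f \<in> topspace X \<rightarrow> topspace Y.
    \<forall>V. openin Y V \<longrightarrow> functionally_F_sigma X {x \<in> topspace X. f x \<in> V}}"

definition discrete_family :: "'a topology \<Rightarrow> 'i set \<Rightarrow> ('i \<Rightarrow> 'a set) \<Rightarrow> bool" where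
  "discrete_family X I A \<longleftrightarrow>
    (\<forall>i\<in>I. A i \<subseteq> topspace X) \<and>
    (\<forall>x\<in>topspace X. \<exists>N. openin X N \<and> x \<in> N \<and>
      (\<forall>i\<in>I. \<forall>j\<in>I. N \<inter> A i \<noteq> {} \<and> N \<inter> A j \<noteq> {} \<longrightarrow> i = j))"

definition sfd_family :: "'a topology \<Rightarrow> 'i set \<Rightarrow> ('i \<Rightarrow> 'a set) \<Rightarrow> bool" where
  "sfd_family X I A \<longleftrightarrow>
    (\<forall>i\<in>I. A i \<subseteq> topspace X) \<and>
    (\<exists>U. discrete_family X I U \<and> (\<forall>i\<in>I. cozero_set X (U i) \<and> X closure_of A i \<subseteq> U i))"

text \<open>The members of an sfd-family indexed by any type whatsoever also form an sfd-family when
  indexed by themselves: repetitions are possible only for the empty set. Hence nothing is lost by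
  using self-indexed families in the definition of \<open>\<sigma>\<close>-sfd below, which avoids quantifying over
  index types.\<close>

lemma sfd_family_image:
  assumes "sfd_family X I A"
  shows "sfd_family X (A ` I) (\<lambda>S. S)"
proof -
  obtain U where sub: "\<forall>i\<in>I. A i \<subseteq> topspace X" and U: "discrete_family X I U"
    and cl: "\<forall>i\<in>I. cozero_set X (U i) \<and> X closure_of A i \<subseteq> U i"
    using assms unfolding sfd_family_def by blast
  define p where "p S = (SOME i. i \<in> I \<and> A i = S)" for S
  have p: "p S \<in> I \<and> A (p S) = S" if "S \<in> A ` I" for S
    unfolding p_def by (rule someI_ex) (use that in blast)
  have "discrete_family X (A ` I) (\<lambda>S. U (p S))"
    unfolding discrete_family_def
  proof (intro conjI ballI)
    fix S assume "S \<in> A ` I"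
    then show "U (p S) \<subseteq> topspace X"
      using U p unfolding discrete_family_def by blast
  next
    fix x assume "x \<in> topspace X"
    with U have "\<exists>N. openin X N \<and> x \<in> N \<and>
        (\<forall>i\<in>I. \<forall>j\<in>I. N \<inter> U i \<noteq> {} \<and> N \<inter> U j \<noteq> {} \<longrightarrow> i = j)"
      unfolding discrete_family_def by (elim conjE) (drule (1) bspec)
    then obtain N where N: "openin X N" "x \<in> N"
      and eq: "\<forall>i\<in>I. \<forall>j\<in>I. N \<inter> U i \<noteq> {} \<and> N \<inter> U j \<noteq> {} \<longrightarrow> i = j"
      by (elim exE conjE)
    show "\<exists>N. openin X N \<and> x \<in> N \<and> (\<forall>S\<in>A ` I. \<forall>T\<in>A ` I.
        N \<inter> U (p S) \<noteq> {} \<and> N \<inter> U (p T) \<noteq> {} \<longrightarrow> S = T)"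
    proof (intro exI[of _ N] conjI ballI impI N)
      fix S T assume S: "S \<in> A ` I" and T: "T \<in> A ` I"
        and ne: "N \<inter> U (p S) \<noteq> {} \<and> N \<inter> U (p T) \<noteq> {}"
      have "p S = p T"
        using eq ne p[OF S, THEN conjunct1] p[OF T, THEN conjunct1] by blast
      then have "A (p S) = A (p T)" by (rule arg_cong)
      then show "S = T"
        unfolding p[OF S, THEN conjunct2] p[OF T, THEN conjunct2] .
    qed
  qed
  moreover have "\<forall>S\<in>A ` I. cozero_set X (U (p S)) \<and> X closure_of S \<subseteq> U (p S)"
  proof
    fix S assume "S \<in> A ` I"
    from p[OF this] have i: "p S \<in> I" and S: "A (p S) = S" by simp_all
    from bspec[OF cl i] show "cozero_set X (U (p S)) \<and> X closure_of S \<subseteq> U (p S)"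
      unfolding S .
  qed
  moreover have "\<forall>S\<in>A ` I. S \<subseteq> topspace X" using sub by simp
  ultimately show ?thesis
    unfolding sfd_family_def by (intro conjI exI[of _ "\<lambda>S. U (p S)"])
qed

definition sigma_sfd :: "'a topology \<Rightarrow> 'a set set \<Rightarrow> bool" where
  "sigma_sfd X \<B> \<longleftrightarrow>
    (\<exists>\<A> :: nat \<Rightarrow> 'a set set. (\<forall>n. sfd_family X (\<A> n) (\<lambda>S. S)) \<and> \<B> = (\<Union>n. \<A> n))"

definition base_for_map :: "'a topology \<Rightarrow> 'b topology \<Rightarrow> ('a \<Rightarrow> 'b) \<Rightarrow> 'a set set \<Rightarrow> bool" where
  "base_for_map X Y f \<B> \<longleftrightarrow>
    (\<forall>B\<in>\<B>. B \<subseteq> topspace X) \<and>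
    (\<forall>V. openin Y V \<longrightarrow> (\<exists>\<U> \<subseteq> \<B>. {x \<in> topspace X. f x \<in> V} = \<Union>\<U>))"

definition Sigma_f :: "'a topology \<Rightarrow> 'b topology \<Rightarrow> ('a \<Rightarrow> 'b) set" where
  "Sigma_f X Y = {f \<in> topspace X \<rightarrow> topspace Y. \<exists>\<B>. base_for_map X Y f \<B> \<and> sigma_sfd X \<B>}"

end

theory Submission
  imports Defs
begin

text \<open>Let \<open>d\<close> be a metric for \<open>Y\<close>.

  A pointwise limit \<open>f\<close> of continuous mappings \<open>F m\<close> lies in K1 because open subsets of \<open>Y\<close> are
  the positivity sets of distance functions (\<open>B1_subset_K1\<close>). It has a \<open>\<sigma>\<close>-sfd base because \<open>Y\<close>, by
  an argument of Stone, is covered at every scale by countably many metrically separated families of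
  small sets (\<open>metrically_separated_pieces\<close>). The preimages of their neighbourhoods under a single
  \<open>F N\<close> form a discrete cozero family, and a point \<open>x\<close> is sorted into one of the preimages according to
  where \<open>F m x\<close> stays for all \<open>m \<ge> N\<close> (\<open>B1_subset_Sigma_f\<close>).

  Conversely, let \<open>f\<close> belong to K1 and have a \<open>\<sigma>\<close>-sfd base, and let \<open>X\<close> be strongly
  zero-dimensional. The idea is to approximate \<open>f\<close> by locally constant mappings. For every
  \<open>\<epsilon> > 0\<close> the two hypotheses together yield countably many sfd-families of zero sets that cover \<open>X\<close>
  and on whose members \<open>f\<close> oscillates by less than \<open>\<epsilon>\<close>; the discrete cozero neighbourhoods can be
  replaced by clopen ones, so that membership is recorded by locally constant labels
  (\<open>K1_Sigma_f_determined_on_zero_sets\<close>). Removing overlaps produces for each \<open>m\<close> one clopen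
  partition and a set \<open>H m\<close> such that \<open>f\<close> oscillates by less than \<open>\<epsilon>\<close> on the trace of \<open>H m\<close> on each cell,
  and every point lies in \<open>H m\<close> for all large \<open>m\<close> (\<open>K1_Sigma_f_determined_eventually\<close>).

  It remains to let \<open>\<epsilon>\<close> tend to \<open>0\<close>. A uniform limit of Baire-one mappings into a space
  without linear structure is not easily seen to be Baire-one, so the approximations for \<open>\<epsilon> = 1 / (k + 1)\<close>
  are combined at once: the \<open>m\<close>-th mapping is constant on the cells of the common refinement
  of the partitions for \<open>k \<le> m\<close>, and its value on a cell is the value of \<open>f\<close> at a point of the cell
  that lies in the sets \<open>H\<close> for as many consecutive \<open>k\<close> as possible (\<open>K1_Sigma_f_subset_B1\<close>).\<close>

section \<open>Zero sets\<close>

lemma zero_set_vanishing: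
  assumes "continuous_map X euclideanreal g"
  shows "zero_set X {x \<in> topspace X. g x = 0}"
proof -
  have "continuous_map X (top_of_set {0..1}) (\<lambda>x. min 1 \<bar>g x\<bar>)"
    using assms by (auto simp: continuous_map_in_subtopology intro!: continuous_intros)
  then show ?thesis
    unfolding zero_set_def by (intro exI[of _ "\<lambda>x. min 1 \<bar>g x\<bar>"]) auto
qed

lemma zero_set_superlevel:
  assumes "continuous_map X euclideanreal g"
  shows "zero_set X {x \<in> topspace X. c \<le> g x}"
proof -
  have "{x \<in> topspace X. c \<le> g x} = {x \<in> topspace X. max 0 (c - g x) = 0}"
    by auto
  moreover have "continuous_map X euclideanreal (\<lambda>x. max 0 (c - g x))"
    using assms by (intro continuous_intros) auto
  ultimately show ?thesis
    by (simp only: zero_set_vanishing)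
qed

lemma zero_setD:
  assumes "zero_set X Z"
  shows "\<exists>g. continuous_map X euclideanreal g \<and> (\<forall>x\<in>topspace X. 0 \<le> g x \<and> g x \<le> 1)
    \<and> Z = {x \<in> topspace X. g x = 0}"
  using assms by (auto simp: zero_set_def continuous_map_in_subtopology Pi_iff image_subset_iff)

lemma cozero_set_sublevel:
  assumes "continuous_map X euclideanreal g"
  shows "cozero_set X {x \<in> topspace X. g x < c}"
  unfolding cozero_set_def
  by (rule exI[of _ "{x \<in> topspace X. c \<le> g x}"]) (use zero_set_superlevel[OF assms] in auto)

text \<open>If \<open>Z n\<close> is the zero set of \<open>g n\<close>, then the intersection is the zero set of
  \<open>\<Sum>n. g n / 2 ^ n\<close>, a uniform limit of continuous functions.\<close>

lemma zero_set_INT: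
  fixes Z :: "nat \<Rightarrow> 'a set"
  assumes "\<And>n. zero_set X (Z n)"
  shows "zero_set X (\<Inter>n. Z n)"
proof -
  have "\<forall>n. \<exists>g. continuous_map X euclideanreal g \<and> (\<forall>x\<in>topspace X. 0 \<le> g x \<and> g x \<le> 1)
      \<and> Z n = {x \<in> topspace X. g x = 0}"
    by (intro allI zero_setD assms)
  from choice[OF this] obtain g where cont: "\<And>n. continuous_map X euclideanreal (g n)"
    and bounds: "\<And>n x. x \<in> topspace X \<Longrightarrow> 0 \<le> g n x \<and> g n x \<le> (1::real)"
    and Z: "\<And>n. Z n = {x \<in> topspace X. g n x = 0}"
    by auto
  define h where "h n x = g n x * (1/2) ^ n" for n x
  have h0: "0 \<le> h n x" if "x \<in> topspace X" for n x
    using bounds[OF that] by (simp add: h_def)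
  have hle: "norm (h n x) \<le> (1/2) ^ n" if "x \<in> topspace X" for n x
    using bounds[OF that, of n] by (simp add: h_def abs_mult mult_left_le_one_le)
  have unif: "uniform_limit (topspace X) (\<lambda>n x. \<Sum>i<n. h i x) (\<lambda>x. suminf (\<lambda>i. h i x)) sequentially"
    by (rule Weierstrass_m_test[where M = "\<lambda>n. (1/2) ^ n"]) (use hle in auto)
  have summ: "summable (\<lambda>i. h i x)" if "x \<in> topspace X" for x
    by (rule summable_comparison_test'[where g = "\<lambda>n. (1/2) ^ n" and N = 0])
      (use hle that in auto)
  have "continuous_map X Met_TC.mtopology (\<lambda>x. suminf (\<lambda>i. h i x))"
  proof (rule Met_TC.continuous_map_uniform_limit[where F = sequentially and f = "\<lambda>n x. \<Sum>i<n. h i x"])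
    show "\<forall>\<^sub>F n in sequentially. continuous_map X Met_TC.mtopology (\<lambda>x. \<Sum>i<n. h i x)"
      using cont by (auto simp: h_def intro!: continuous_intros always_eventually)
    show "\<forall>\<^sub>F n in sequentially. \<forall>x\<in>topspace X. (\<Sum>i. h i x) \<in> UNIV
        \<and> dist (\<Sum>i<n. h i x) (\<Sum>i. h i x) < e" if "0 < e" for e
      using uniform_limitD[OF unif that] by simp
  qed auto
  then have "zero_set X {x \<in> topspace X. suminf (\<lambda>i. h i x) = 0}"
    by (intro zero_set_vanishing) simp
  moreover have "{x \<in> topspace X. suminf (\<lambda>i. h i x) = 0} = (\<Inter>n. Z n)"
  proof -
    have "suminf (\<lambda>i. h i x) = 0 \<longleftrightarrow> (\<forall>n. g n x = 0)" if "x \<in> topspace X" for x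
      using suminf_eq_zero_iff[OF summ[OF that] h0[OF that]] by (simp add: h_def)
    then show ?thesis
      by (auto simp: Z)
  qed
  ultimately show ?thesis by simp
qed

section \<open>Truncated distance to a set\<close>

text \<open>The truncation at 1 gives a sensible value to the distance from the empty set, which occurs
  as the complement of the whole space and as a piece of a separated family.\<close>

definition trunc_setdist :: "('b \<Rightarrow> 'b \<Rightarrow> real) \<Rightarrow> 'b set \<Rightarrow> 'b \<Rightarrow> real" where
  "trunc_setdist d A x = Inf (insert 1 (d x ` A))"

context Metric_space
begin

lemma trunc_setdist_bdd: "bdd_below (insert 1 (d x ` A))"
  by (rule bdd_belowI[of _ 0]) auto

lemma trunc_setdist_nonneg: "0 \<le> trunc_setdist d A x"
  unfolding trunc_setdist_def by (rule cInf_greatest) auto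

lemma trunc_setdist_le_1: "trunc_setdist d A x \<le> 1"
  unfolding trunc_setdist_def by (rule cInf_lower) (use trunc_setdist_bdd in auto)

lemma trunc_setdist_le: "a \<in> A \<Longrightarrow> trunc_setdist d A x \<le> d x a"
  unfolding trunc_setdist_def by (rule cInf_lower) (use trunc_setdist_bdd in auto)

lemma trunc_setdist_less:
  assumes "trunc_setdist d A x < e" "e \<le> 1"
  obtains a where "a \<in> A" "d x a < e"
  using assms cInf_lessD[of "insert 1 (d x ` A)" e] unfolding trunc_setdist_def by force

lemma trunc_setdist_zero:
  assumes "x \<in> A" "x \<in> M" shows "trunc_setdist d A x = 0"
  using trunc_setdist_le[OF assms(1), of x] trunc_setdist_nonneg[of A x] assms(2) by simp

lemma trunc_setdist_triangle:
  assumes "A \<subseteq> M" "x \<in> M" "y \<in> M"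
  shows "trunc_setdist d A x \<le> trunc_setdist d A y + d x y"
proof -
  have "trunc_setdist d A x - d x y \<le> s" if s: "s \<in> insert 1 (d y ` A)" for s
  proof (cases "s = 1")
    case True
    then show ?thesis
      using trunc_setdist_le_1[of A x] nonneg[of x y] by linarith
  next
    case False
    then obtain a where a: "a \<in> A" "s = d y a" using s by auto
    then have "d x a \<le> d x y + d y a"
      using assms by (intro triangle) auto
    then show ?thesis
      using trunc_setdist_le[OF a(1), of x] a by linarith
  qed
  then have "trunc_setdist d A x - d x y \<le> trunc_setdist d A y"
    unfolding trunc_setdist_def[of d A y] by (intro cInf_greatest) auto
  then show ?thesis by simp
qed

lemma continuous_map_trunc_setdist:
  assumes "A \<subseteq> M"
  shows "continuous_map mtopology euclideanreal (trunc_setdist d A)"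
proof -
  have "\<bar>trunc_setdist d A x - trunc_setdist d A y\<bar> \<le> d x y" if "x \<in> M" "y \<in> M" for x y
    using trunc_setdist_triangle[OF assms that] trunc_setdist_triangle[OF assms that(2,1)]
      commute[of x y] by linarith
  then have "\<forall>x. x \<in> M \<and> d a x < e \<longrightarrow> dist (trunc_setdist d A a) (trunc_setdist d A x) < e"
    if "a \<in> M" for a e
    using that unfolding dist_real_def by (meson le_less_trans)
  then have "continuous_map mtopology Met_TC.mtopology (trunc_setdist d A)"
    unfolding metric_continuous_map[OF Met_TC.Metric_space_axioms] by (simp, metis)
  then show ?thesis by simp
qed

lemma continuous_map_trunc_setdist_compose:
  assumes "A \<subseteq> M" "continuous_map X mtopology h"
  shows "continuous_map X euclideanreal (\<lambda>x. trunc_setdist d A (h x))"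
  using continuous_map_compose[OF assms(2) continuous_map_trunc_setdist[OF assms(1)]]
  by (simp add: o_def)

lemma tendsto_trunc_setdist:
  assumes "A \<subseteq> M" "limitin mtopology s l F"
  shows "((\<lambda>n. trunc_setdist d A (s n)) \<longlongrightarrow> trunc_setdist d A l) F"
  using continuous_map_limit[OF continuous_map_trunc_setdist[OF assms(1)] assms(2)]
  by (simp add: o_def)

lemma trunc_setdist_pos_iff:
  assumes "openin mtopology V" "y \<in> M"
  shows "0 < trunc_setdist d (M - V) y \<longleftrightarrow> y \<in> V"
proof
  assume "0 < trunc_setdist d (M - V) y"
  then show "y \<in> V"
    using trunc_setdist_zero[of y "M - V"] assms(2) by force
next
  assume "y \<in> V"
  then obtain r where r: "r > 0" "mball y r \<subseteq> V"
    using assms(1) openin_mtopology by blast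
  show "0 < trunc_setdist d (M - V) y"
  proof (rule ccontr)
    assume "\<not> 0 < trunc_setdist d (M - V) y"
    then have "trunc_setdist d (M - V) y < min r 1"
      using r(1) by simp
    then obtain a where "a \<in> M - V" "d y a < min r 1"
      by (rule trunc_setdist_less) simp_all
    then show False
      using r(2) assms(2) by auto
  qed
qed

section \<open>Baire-one mappings belong to the class K1\<close>

text \<open>Write \<open>\<phi>\<close> for the distance to the complement of an open set \<open>V\<close>. The limit of \<open>F m x\<close> lies in
  \<open>V\<close> if and only if \<open>\<phi> (F m x)\<close> is eventually bounded away from \<open>0\<close>, and for a fixed bound and a
  fixed starting index that condition defines a countable intersection of zero sets.\<close>

lemma B1_subset_K1: "B1 X mtopology \<subseteq> K1 X mtopology"
proof
  fix f assume "f \<in> B1 X mtopology"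
  then obtain F where f: "f \<in> topspace X \<rightarrow> M"
    and F: "\<And>n. continuous_map X mtopology (F n)"
    and lim: "\<And>x. x \<in> topspace X \<Longrightarrow> limitin mtopology (\<lambda>n. F n x) (f x) sequentially"
    unfolding B1_def by auto
  have "functionally_F_sigma X {x \<in> topspace X. f x \<in> V}" if V: "openin mtopology V" for V
  proof -
    define \<phi> where "\<phi> = trunc_setdist d (M - V)"
    define Z where "Z i m = {x \<in> topspace X. 1 / Suc (fst (prod_decode i)) \<le> \<phi> (F (snd (prod_decode i) + m) x)}"
      for i m
    have "zero_set X (\<Inter>m. Z i m)" for i
      unfolding Z_def \<phi>_def
      by (intro zero_set_INT zero_set_superlevel continuous_map_trunc_setdist_compose F) auto
    moreover have "{x \<in> topspace X. f x \<in> V} = (\<Union>i. \<Inter>m. Z i m)"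
    proof (intro subset_antisym subsetI)
      fix x assume "x \<in> {x \<in> topspace X. f x \<in> V}"
      then have x: "x \<in> topspace X" "f x \<in> V" by auto
      then have "0 < \<phi> (f x)"
        using trunc_setdist_pos_iff[OF V] f by (auto simp: \<phi>_def)
      then obtain k where k: "1 / Suc k < \<phi> (f x)"
        by (rule nat_approx_posE)
      have "(\<lambda>n. \<phi> (F n x)) \<longlonglongrightarrow> \<phi> (f x)"
        unfolding \<phi>_def by (intro tendsto_trunc_setdist lim x) auto
      from order_tendstoD(1)[OF this k] obtain N where "\<And>n. n \<ge> N \<Longrightarrow> 1 / Suc k < \<phi> (F n x)"
        by (auto simp: eventually_sequentially)
      then have "x \<in> Z (prod_encode (k, N)) m" for m
        using x by (simp add: Z_def less_imp_le)
      then show "x \<in> (\<Union>i. \<Inter>m. Z i m)" by blast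
    next
      fix x assume "x \<in> (\<Union>i. \<Inter>m. Z i m)"
      then obtain i where i: "\<And>m. x \<in> Z i m" by blast
      define k N where "k = fst (prod_decode i)" and "N = snd (prod_decode i)"
      have x: "x \<in> topspace X" and le: "1 / Suc k \<le> \<phi> (F (N + m) x)" for m
        using i[of m] by (simp_all add: Z_def k_def N_def)
      have "1 / Suc k \<le> \<phi> (F n x)" if "N \<le> n" for n
        using le[of "n - N"] that by simp
      then have "\<forall>\<^sub>F n in sequentially. 1 / Suc k \<le> \<phi> (F n x)"
        unfolding eventually_sequentially by blast
      moreover have "(\<lambda>n. \<phi> (F n x)) \<longlonglongrightarrow> \<phi> (f x)"
        unfolding \<phi>_def by (intro tendsto_trunc_setdist lim x) auto
      ultimately have "1 / Suc k \<le> \<phi> (f x)"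
        by (intro tendsto_lowerbound) auto
      then have "0 < \<phi> (f x)"
        by (rule less_le_trans[rotated]) simp
      then show "x \<in> {x \<in> topspace X. f x \<in> V}"
        using trunc_setdist_pos_iff[OF V] f x by (auto simp: \<phi>_def)
    qed
    ultimately show ?thesis
      unfolding functionally_F_sigma_def by (intro exI[of _ "\<lambda>i. \<Inter>m. Z i m"] conjI allI)
  qed
  then show "f \<in> K1 X mtopology"
    using f unfolding K1_def by simp
qed

section \<open>Baire-one mappings have sigma-sfd bases\<close>

text \<open>This is the combinatorial core of the theorem of A. H. Stone on the paracompactness of
  metric spaces. Well-order the space and assign each point \<open>p\<close> to the ball \<open>mball y e\<close> with the
  least centre \<open>y\<close> among those that contain \<open>p\<close>; put \<open>p\<close> into \<open>A n y\<close> if the concentric ball of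
  radius \<open>1 / (n + 1)\<close> around \<open>p\<close> still lies in \<open>mball y e\<close>. A point assigned to a later centre \<open>z\<close>
  avoids \<open>mball y e\<close>, hence is at distance at least \<open>1 / (n + 1)\<close> from \<open>A n y\<close>.\<close>

lemma metrically_separated_pieces:
  assumes "0 < e"
  shows "\<exists>A :: nat \<Rightarrow> 'a \<Rightarrow> 'a set. (\<forall>n y. A n y \<subseteq> mball y e)
    \<and> (\<forall>n y z p q. y \<noteq> z \<longrightarrow> p \<in> A n y \<longrightarrow> q \<in> A n z \<longrightarrow> 1 / Suc n \<le> d p q)
    \<and> (\<forall>p\<in>M. \<forall>\<^sub>F n in sequentially. \<exists>y. p \<in> A n y)"
proof -
  obtain r :: "'a rel" where r: "well_order_on UNIV r"
    using well_order_on by blast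
  then have wf: "wf (r - Id)" and tot: "\<And>y z. y \<noteq> z \<Longrightarrow> (y, z) \<in> r - Id \<or> (z, y) \<in> r - Id"
    by (auto simp: well_order_on_def linear_order_on_def total_on_def)
  define A where "A n y = {p \<in> mball y e. (\<forall>z. (z, y) \<in> r - Id \<longrightarrow> p \<notin> mball z e)
    \<and> mball p (1 / Suc n) \<subseteq> mball y e}" for n y
  have earlier: "1 / Suc n \<le> d p q" if "(y, z) \<in> r - Id" "p \<in> A n y" "q \<in> A n z" for n y z p q
  proof -
    have "q \<notin> mball p (1 / Suc n)" "p \<in> M" "q \<in> M"
      using that unfolding A_def by auto
    then show ?thesis by simp
  qed
  show ?thesis
  proof (intro exI[of _ A] conjI allI impI ballI)
    show "A n y \<subseteq> mball y e" for n y
      by (auto simp: A_def)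
    show "1 / Suc n \<le> d p q" if "y \<noteq> z" "p \<in> A n y" "q \<in> A n z" for n y z p q
      using tot[OF that(1)]
    proof
      assume "(y, z) \<in> r - Id"
      then show ?thesis using earlier that(2,3) by blast
    next
      assume "(z, y) \<in> r - Id"
      then have "1 / Suc n \<le> d q p" using earlier that(2,3) by blast
      then show ?thesis by (simp add: commute)
    qed
    fix p assume p: "p \<in> M"
    then have "p \<in> {y. p \<in> mball y e}" using assms by simp
    then obtain y where "y \<in> {y. p \<in> mball y e}"
      and "\<And>z. (z, y) \<in> r - Id \<Longrightarrow> z \<notin> {y. p \<in> mball y e}"
      by (rule wfE_min[OF wf]) iprover
    then have y: "p \<in> mball y e" and least: "\<And>z. (z, y) \<in> r - Id \<Longrightarrow> p \<notin> mball z e"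
      by simp_all
    then obtain s where s: "s > 0" "mball p s \<subseteq> mball y e"
      using openin_mball[of y e] unfolding openin_mtopology by blast
    obtain N where N: "1 / Suc N < s"
      using s(1) by (rule nat_approx_posE)
    have "p \<in> A n y" if "N \<le> n" for n
    proof -
      have "1 / Suc n \<le> s"
        using N that by (smt (verit) frac_le of_nat_0_less_iff of_nat_mono Suc_le_mono zero_less_Suc)
      then have "mball p (1 / Suc n) \<subseteq> mball y e"
        using s(2) mball_subset_concentric by blast
      then show ?thesis
        using y least by (auto simp: A_def)
    qed
    then show "\<forall>\<^sub>F n in sequentially. \<exists>y. p \<in> A n y"
      by (auto simp: eventually_sequentially)
  qed
qed

text \<open>Around the pieces of a metrically separated family the neighbourhoods of radius \<open>\<delta> / 3\<close> are
  still \<open>\<delta> / 3\<close>-separated, so a ball of radius \<open>\<delta> / 6\<close> meets at most one of them; continuous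
  preimages inherit this.\<close>

lemma sfd_family_separated_preimage:
  assumes h: "continuous_map X mtopology h" and "0 < \<delta>" "\<delta> \<le> 1"
    and AM: "\<And>y. A y \<subseteq> M"
    and sep: "\<And>y z p q. \<lbrakk>y \<noteq> z; p \<in> A y; q \<in> A z\<rbrakk> \<Longrightarrow> \<delta> \<le> d p q"
    and E: "\<And>y. E y \<subseteq> {x \<in> topspace X. trunc_setdist d (A y) (h x) \<le> \<delta> / 4}"
  shows "sfd_family X I E"
proof -
  have hM: "h x \<in> M" if "x \<in> topspace X" for x
    using continuous_map_image_subset_topspace[OF h] that by auto
  define U where "U y = {x \<in> topspace X. trunc_setdist d (A y) (h x) < \<delta> / 3}" for y
  have cont: "continuous_map X euclideanreal (\<lambda>x. trunc_setdist d (A y) (h x))" for y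
    by (intro continuous_map_trunc_setdist_compose AM h)
  have "discrete_family X I U"
    unfolding discrete_family_def
  proof (intro conjI ballI)
    fix x assume x: "x \<in> topspace X"
    define N where "N = {z \<in> topspace X. h z \<in> mball (h x) (\<delta> / 6)}"
    have "openin X N"
      unfolding N_def using h by (intro openin_continuous_map_preimage) auto
    moreover have "x \<in> N"
      using x hM \<open>0 < \<delta>\<close> by (simp add: N_def)
    moreover have "i = j" if ne: "N \<inter> U i \<noteq> {}" "N \<inter> U j \<noteq> {}" for i j
    proof (rule ccontr)
      assume "i \<noteq> j"
      obtain p q where p: "p \<in> N" "p \<in> U i" and q: "q \<in> N" "q \<in> U j"
        using ne by auto
      have "trunc_setdist d (A i) (h p) < \<delta> / 3"
        using p by (simp add: U_def)
      then obtain a where a: "a \<in> A i" "d (h p) a < \<delta> / 3"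
        by (rule trunc_setdist_less) (use \<open>\<delta> \<le> 1\<close> in simp)
      have "trunc_setdist d (A j) (h q) < \<delta> / 3"
        using q by (simp add: U_def)
      then obtain b where b: "b \<in> A j" "d (h q) b < \<delta> / 3"
        by (rule trunc_setdist_less) (use \<open>\<delta> \<le> 1\<close> in simp)
      have M: "h p \<in> M" "h q \<in> M" "h x \<in> M" "a \<in> M" "b \<in> M"
        and near: "d (h x) (h p) < \<delta> / 6" "d (h x) (h q) < \<delta> / 6"
        using p q a b AM by (auto simp: N_def)
      have "d a b \<le> d a (h p) + d (h p) b" "d (h p) b \<le> d (h p) (h q) + d (h q) b"
        "d (h p) (h q) \<le> d (h p) (h x) + d (h x) (h q)"
        using M by (auto intro: triangle)
      then have "d a b < \<delta>"
        using a(2) b(2) near commute[of a "h p"] commute[of "h p" "h x"] by linarith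
      then show False
        using sep[OF \<open>i \<noteq> j\<close> a(1) b(1)] by linarith
    qed
    ultimately show "\<exists>N. openin X N \<and> x \<in> N
        \<and> (\<forall>i\<in>I. \<forall>j\<in>I. N \<inter> U i \<noteq> {} \<and> N \<inter> U j \<noteq> {} \<longrightarrow> i = j)"
      by blast
  qed (auto simp: U_def)
  moreover have "cozero_set X (U i)" for i
    unfolding U_def by (intro cozero_set_sublevel cont)
  moreover have "X closure_of E i \<subseteq> U i" for i
  proof -
    have "closedin X {x \<in> topspace X. trunc_setdist d (A i) (h x) \<in> {..\<delta> / 4}}"
      by (rule closedin_continuous_map_preimage[OF cont]) simp
    then have "X closure_of E i \<subseteq> {x \<in> topspace X. trunc_setdist d (A i) (h x) \<le> \<delta> / 4}"
      using E[of i] by (intro closure_of_minimal) auto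
    then show ?thesis
      using \<open>0 < \<delta>\<close> by (auto simp: U_def)
  qed
  ultimately show ?thesis
    using E unfolding sfd_family_def by blast
qed

text \<open>The family below is indexed by a resolution \<open>1 / (j + 1)\<close>, a degree of separation
  \<open>1 / (n + 1)\<close> and a time \<open>N\<close> after which the approximations of a point must stay near the piece
  \<open>A n y\<close>. Staying near passes to the limit, so \<open>f\<close> maps the set into a small neighbourhood of
  the piece; as the bound is already imposed on the single continuous mapping \<open>F N\<close>, the family is
  strongly functionally discrete.\<close>

lemma B1_subset_Sigma_f: "B1 X mtopology \<subseteq> Sigma_f X mtopology"
proof
  fix f assume "f \<in> B1 X mtopology"
  then obtain F where f: "f \<in> topspace X \<rightarrow> M"
    and F: "\<And>n. continuous_map X mtopology (F n)"
    and lim: "\<And>x. x \<in> topspace X \<Longrightarrow> limitin mtopology (\<lambda>n. F n x) (f x) sequentially"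
    unfolding B1_def by auto
  have "\<exists>A. (\<forall>n y. A n y \<subseteq> mball y (1 / Suc j))
      \<and> (\<forall>n y z p q. y \<noteq> z \<longrightarrow> p \<in> A n y \<longrightarrow> q \<in> A n z \<longrightarrow> 1 / Suc n \<le> d p q)
      \<and> (\<forall>p\<in>M. \<forall>\<^sub>F n in sequentially. \<exists>y. p \<in> A n y)" for j
  proof -
    have "0 < 1 / real (Suc j)" by simp
    then show ?thesis by (rule metrically_separated_pieces)
  qed
  then obtain A :: "nat \<Rightarrow> nat \<Rightarrow> 'a \<Rightarrow> 'a set" where
      small: "\<And>j n y. A j n y \<subseteq> mball y (1 / Suc j)"
    and sep: "\<And>j n y z p q. \<lbrakk>y \<noteq> z; p \<in> A j n y; q \<in> A j n z\<rbrakk> \<Longrightarrow> 1 / Suc n \<le> d p q"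
    and cover: "\<And>j p. p \<in> M \<Longrightarrow> \<forall>\<^sub>F n in sequentially. \<exists>y. p \<in> A j n y"
    by metis
  have AM: "A j n y \<subseteq> M" for j n y
    using small[of j n y] mball_subset_mspace by blast
  define E where "E j n N y = {x \<in> topspace X. \<forall>m\<ge>N. trunc_setdist d (A j n y) (F m x) \<le> 1 / Suc n / 4}"
    for j n N y
  define \<A> where "\<A> i = (case prod_decode i of (j, i') \<Rightarrow> case prod_decode i' of (n, N) \<Rightarrow> range (E j n N))"
    for i
  have sfd: "sfd_family X (\<A> i) (\<lambda>S. S)" for i
  proof -
    obtain j i' where ji: "prod_decode i = (j, i')" by fastforce
    obtain n N where nN: "prod_decode i' = (n, N)" by fastforce
    have "sfd_family X UNIV (E j n N)"
    proof (rule sfd_family_separated_preimage)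
      show "continuous_map X mtopology (F N)" by (rule F)
      show "A j n y \<subseteq> M" for y by (rule AM)
      show "1 / Suc n \<le> d p q" if "y \<noteq> z" "p \<in> A j n y" "q \<in> A j n z" for y z p q
        using sep that .
    qed (auto simp: E_def)
    from sfd_family_image[OF this] show ?thesis
      by (simp add: \<A>_def ji nN)
  qed
  have E_in: "E j n N y \<in> (\<Union>i. \<A> i)" for j n N y
  proof
    show "E j n N y \<in> \<A> (prod_encode (j, prod_encode (n, N)))"
      by (simp add: \<A>_def)
  qed simp
  have sub: "S \<subseteq> topspace X" if "S \<in> (\<Union>i. \<A> i)" for S
    using that sfd unfolding sfd_family_def by blast
  have "base_for_map X mtopology f (\<Union>i. \<A> i)"
    unfolding base_for_map_def
  proof (intro conjI ballI allI impI)
    fix V assume V: "openin mtopology V"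
    have "\<exists>S\<in>(\<Union>i. \<A> i). x \<in> S \<and> S \<subseteq> {x \<in> topspace X. f x \<in> V}"
      if x: "x \<in> topspace X" "f x \<in> V" for x
    proof -
      obtain r where r: "r > 0" "mball (f x) r \<subseteq> V"
        using V x(2) unfolding openin_mtopology by blast
      have "0 < r / 3" using r(1) by simp
      then obtain j where j: "1 / Suc j < r / 3"
        by (rule nat_approx_posE)
      have fx: "f x \<in> M" using f x by blast
      have "\<forall>\<^sub>F n in sequentially. j \<le> n \<and> (\<exists>y. f x \<in> A j n y)"
        using cover[OF fx, of j] eventually_ge_at_top[of j] by eventually_elim blast
      then obtain n y where n: "j \<le> n" and y: "f x \<in> A j n y"
        using eventually_happens'[OF sequentially_bot] by blast
      have "(\<lambda>m. trunc_setdist d (A j n y) (F m x)) \<longlonglongrightarrow> trunc_setdist d (A j n y) (f x)"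
        by (intro tendsto_trunc_setdist lim x AM)
      then have "(\<lambda>m. trunc_setdist d (A j n y) (F m x)) \<longlonglongrightarrow> 0"
        by (simp only: trunc_setdist_zero[OF y fx])
      then have "\<forall>\<^sub>F m in sequentially. trunc_setdist d (A j n y) (F m x) < 1 / Suc n / 4"
        by (rule order_tendstoD) simp
      then obtain N where "\<And>m. m \<ge> N \<Longrightarrow> trunc_setdist d (A j n y) (F m x) < 1 / Suc n / 4"
        unfolding eventually_sequentially by blast
      then have "x \<in> E j n N y"
        using x(1) by (simp add: E_def less_imp_le)
      moreover have "f z \<in> V" if z: "z \<in> E j n N y" for z
      proof -
        have zX: "z \<in> topspace X" using z by (simp add: E_def)
        then have fz: "f z \<in> M" using f by blast
        have "(\<lambda>m. trunc_setdist d (A j n y) (F m z)) \<longlonglongrightarrow> trunc_setdist d (A j n y) (f z)"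
          by (intro tendsto_trunc_setdist lim zX AM)
        moreover have "\<forall>\<^sub>F m in sequentially. trunc_setdist d (A j n y) (F m z) \<le> 1 / Suc n / 4"
          using eventually_ge_at_top[of N] by (rule eventually_mono) (use z in \<open>simp add: E_def\<close>)
        ultimately have "trunc_setdist d (A j n y) (f z) \<le> 1 / Suc n / 4"
          by (rule tendsto_upperbound) simp
        also have "1 / Suc n / 4 < 1 / Suc n" by (simp add: field_simps)
        also have "1 / Suc n \<le> 1 / Suc j" using n by (simp add: frac_le)
        finally have "trunc_setdist d (A j n y) (f z) < 1 / Suc j" .
        then obtain a where a: "a \<in> A j n y" "d (f z) a < 1 / Suc j"
          by (rule trunc_setdist_less) simp
        have M: "a \<in> M" "y \<in> M" and ay: "d y a < 1 / Suc j" and xy: "d y (f x) < 1 / Suc j"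
          using small[of j n y] a(1) y by auto
        have "d (f x) (f z) \<le> d (f x) y + d y (f z)" "d y (f z) \<le> d y a + d a (f z)"
          using M fx fz by (auto intro: triangle)
        then have "d (f x) (f z) < r"
          using ay xy a(2) j commute[of "f x" y] commute[of a "f z"] by linarith
        then show ?thesis using r(2) fx fz by auto
      qed
      moreover have "E j n N y \<subseteq> topspace X"
        by (auto simp: E_def)
      ultimately have "x \<in> E j n N y \<and> E j n N y \<subseteq> {x \<in> topspace X. f x \<in> V}"
        by blast
      then show ?thesis
        by (rule bexI[OF _ E_in])
    qed
    then have "{x \<in> topspace X. f x \<in> V}
        = \<Union>{S \<in> (\<Union>i. \<A> i). S \<subseteq> {x \<in> topspace X. f x \<in> V}}"
      by blast
    then show "\<exists>\<U>\<subseteq>(\<Union>i. \<A> i). {x \<in> topspace X. f x \<in> V} = \<Union>\<U>"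
      by (intro exI conjI) (rule Collect_subset)
  qed (rule sub)
  moreover have "sigma_sfd X (\<Union>i. \<A> i)"
    unfolding sigma_sfd_def by (intro exI[of _ \<A>] conjI allI sfd refl)
  ultimately show "f \<in> Sigma_f X mtopology"
    using f unfolding Sigma_f_def by (auto simp only: topspace_mtopology mem_Collect_eq)
qed

end

section \<open>Locally constant labellings\<close>

text \<open>A locally constant labelling, with labels in an arbitrary set, encodes a partition into
  clopen sets.\<close>

definition locally_constant :: "'a topology \<Rightarrow> ('a \<Rightarrow> 'c) \<Rightarrow> bool" where
  "locally_constant X q \<longleftrightarrow>
    (\<forall>x\<in>topspace X. \<exists>N. openin X N \<and> x \<in> N \<and> (\<forall>z\<in>N. q z = q x))"

lemma locally_constantE:
  assumes "locally_constant X q" "x \<in> topspace X"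
  obtains N where "openin X N" "x \<in> N" "\<And>z. z \<in> N \<Longrightarrow> q z = q x"
proof -
  have "\<exists>N. openin X N \<and> x \<in> N \<and> (\<forall>z\<in>N. q z = q x)"
    using assms unfolding locally_constant_def by (rule bspec)
  then show thesis using that by auto
qed

lemma locally_constant_finite_family:
  assumes "finite I" "\<And>i. i \<in> I \<Longrightarrow> locally_constant X (q i)" "x \<in> topspace X"
  shows "\<exists>N. openin X N \<and> x \<in> N \<and> (\<forall>z\<in>N. \<forall>i\<in>I. q i z = q i x)"
  using assms(1,2)
proof (induction I rule: finite_induct)
  case empty
  then show ?case using assms(3) by blast
next
  case (insert i I)
  then obtain N where N: "openin X N" "x \<in> N" "\<forall>z\<in>N. \<forall>i\<in>I. q i z = q i x"
    by auto
  have "locally_constant X (q i)" using insert.prems by simp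
  then obtain N' where "openin X N'" "x \<in> N'" "\<And>z. z \<in> N' \<Longrightarrow> q i z = q i x"
    using assms(3) by (rule locally_constantE) blast
  then show ?case
    using N by (intro exI[of _ "N \<inter> N'"] conjI openin_Int) blast+
qed

lemma locally_constant_mem_clopen:
  assumes "openin X U" "closedin X U"
  shows "locally_constant X (\<lambda>x. x \<in> U)"
  unfolding locally_constant_def
proof
  fix x assume x: "x \<in> topspace X"
  show "\<exists>N. openin X N \<and> x \<in> N \<and> (\<forall>z\<in>N. (z \<in> U) = (x \<in> U))"
  proof (cases "x \<in> U")
    case True
    then show ?thesis using assms(1) by blast
  next
    case False
    have "openin X (topspace X - U)"
      using assms(2) by blast
    then show ?thesis using False x by blast
  qed
qed

lemma locally_constant_select:
  assumes "locally_constant X j" "\<And>i. locally_constant X (t i)"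
  shows "locally_constant X (\<lambda>x. (j x, t (j x) x))"
  unfolding locally_constant_def
proof
  fix x assume x: "x \<in> topspace X"
  obtain N where N: "openin X N" "x \<in> N" "\<And>z. z \<in> N \<Longrightarrow> j z = j x"
    using assms(1) x by (rule locally_constantE) blast
  obtain N' where N': "openin X N'" "x \<in> N'" "\<And>z. z \<in> N' \<Longrightarrow> t (j x) z = t (j x) x"
    using assms(2) x by (rule locally_constantE) blast
  have "(j z, t (j z) z) = (j x, t (j x) x)" if "z \<in> N \<inter> N'" for z
    using N(3)[of z] N'(3)[of z] that by simp
  then show "\<exists>N. openin X N \<and> x \<in> N \<and> (\<forall>z\<in>N. (j z, t (j z) z) = (j x, t (j x) x))"
    using N N' by (intro exI[of _ "N \<inter> N'"] conjI openin_Int) blast+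
qed

lemma continuous_map_locally_constant_select:
  assumes t: "locally_constant X t" and G: "\<And>c. continuous_map X Y (G c)"
  shows "continuous_map X Y (\<lambda>x. G (t x) x)"
  unfolding continuous_map_def
proof (intro conjI allI impI)
  show "(\<lambda>x. G (t x) x) \<in> topspace X \<rightarrow> topspace Y"
    using G continuous_map_image_subset_topspace by blast
  fix V assume V: "openin Y V"
  show "openin X {x \<in> topspace X. G (t x) x \<in> V}"
    unfolding openin_subopen[of X "{x \<in> topspace X. G (t x) x \<in> V}"]
  proof
    fix x assume "x \<in> {x \<in> topspace X. G (t x) x \<in> V}"
    then have x: "x \<in> topspace X" "G (t x) x \<in> V" by auto
    obtain N where N: "openin X N" "x \<in> N" "\<And>z. z \<in> N \<Longrightarrow> t z = t x"
      using t x(1) by (rule locally_constantE) blast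
    have "openin X (N \<inter> {z \<in> topspace X. G (t x) z \<in> V})"
      using N(1) openin_continuous_map_preimage[OF G V] by blast
    moreover have "G (t z) z \<in> V" if "z \<in> N" "G (t x) z \<in> V" for z
      using N(3)[OF that(1)] that(2) by simp
    ultimately show "\<exists>T. openin X T \<and> x \<in> T \<and> T \<subseteq> {x \<in> topspace X. G (t x) x \<in> V}"
      using x N(2) by (intro exI[of _ "N \<inter> {z \<in> topspace X. G (t x) z \<in> V}"] conjI) blast+
  qed
qed

lemma locally_constant_imp_continuous_map:
  assumes "locally_constant X h" "h \<in> topspace X \<rightarrow> topspace Y"
  shows "continuous_map X Y h"
  unfolding continuous_map_def
proof (intro conjI allI impI assms(2))
  fix V assume "openin Y V"
  show "openin X {x \<in> topspace X. h x \<in> V}"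
    unfolding openin_subopen[of X "{x \<in> topspace X. h x \<in> V}"]
  proof
    fix x assume "x \<in> {x \<in> topspace X. h x \<in> V}"
    then have x: "x \<in> topspace X" "h x \<in> V" by auto
    obtain N where N: "openin X N" "x \<in> N" "\<And>z. z \<in> N \<Longrightarrow> h z = h x"
      using assms(1) x(1) by (rule locally_constantE) blast
    have "h z \<in> V" if "z \<in> N" for z
      using N(3)[OF that] x(2) by simp
    then show "\<exists>T. openin X T \<and> x \<in> T \<and> T \<subseteq> {x \<in> topspace X. h x \<in> V}"
      using N(1,2) openin_subset[OF N(1)] by (intro exI[of _ N] conjI) blast+
  qed
qed

text \<open>A discrete family of clopen sets admits a labelling that tells in which member a point lies:
  near a point at most one member matters.\<close>

lemma discrete_clopen_family_labelling:
  assumes disc: "discrete_family X I C" and clopen: "\<And>i. i \<in> I \<Longrightarrow> openin X (C i) \<and> closedin X (C i)"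
  shows "\<exists>t :: 'a \<Rightarrow> 'i option. locally_constant X t \<and> (\<forall>i\<in>I. \<forall>x\<in>C i. t x = Some i)"
proof -
  have nbhd: "\<exists>N. openin X N \<and> x \<in> N \<and> (\<forall>i\<in>I. \<forall>j\<in>I. N \<inter> C i \<noteq> {} \<and> N \<inter> C j \<noteq> {} \<longrightarrow> i = j)"
    if "x \<in> topspace X" for x
    using disc that unfolding discrete_family_def by (elim conjE) (drule (1) bspec)
  have CX: "C i \<subseteq> topspace X" if "i \<in> I" for i
    using disc that unfolding discrete_family_def by blast
  have uniq: "i = j" if "i \<in> I" "j \<in> I" "x \<in> C i" "x \<in> C j" for i j x
  proof -
    have "x \<in> topspace X" using CX that by blast
    from nbhd[OF this] obtain N where "x \<in> N"
      and one: "\<forall>i\<in>I. \<forall>j\<in>I. N \<inter> C i \<noteq> {} \<and> N \<inter> C j \<noteq> {} \<longrightarrow> i = j"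
      by (elim exE conjE)
    then show ?thesis
      using that by (intro one[rule_format]) auto
  qed
  define t where "t x = (if \<exists>i\<in>I. x \<in> C i then Some (SOME i. i \<in> I \<and> x \<in> C i) else None)" for x
  have t_Some: "t x = Some i" if i: "i \<in> I" "x \<in> C i" for i x
  proof -
    have "(SOME i. i \<in> I \<and> x \<in> C i) = i"
      using i uniq by (intro some_equality) blast+
    then show ?thesis using i by (auto simp: t_def)
  qed
  have t_None: "t x = None" if "\<And>i. i \<in> I \<Longrightarrow> x \<notin> C i" for x
    using that by (auto simp: t_def)
  have "locally_constant X t"
    unfolding locally_constant_def
  proof
    fix x assume x: "x \<in> topspace X"
    from nbhd[OF x] obtain N where N: "openin X N" "x \<in> N"
      and one: "\<forall>i\<in>I. \<forall>j\<in>I. N \<inter> C i \<noteq> {} \<and> N \<inter> C j \<noteq> {} \<longrightarrow> i = j"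
      by (elim exE conjE)
    show "\<exists>N. openin X N \<and> x \<in> N \<and> (\<forall>z\<in>N. t z = t x)"
    proof (cases "\<exists>i\<in>I. N \<inter> C i \<noteq> {}")
      case False
      then have "t z = None" if "z \<in> N" for z
        using that by (intro t_None) blast
      then have "t z = t x" if "z \<in> N" for z
        using that N(2) by simp
      then show ?thesis using N by blast
    next
      case True
      then obtain i where i: "i \<in> I" "N \<inter> C i \<noteq> {}" by blast
      obtain N' where N': "openin X N'" "x \<in> N'" "\<And>z. z \<in> N' \<Longrightarrow> (z \<in> C i) = (x \<in> C i)"
        using locally_constant_mem_clopen[of X "C i"] clopen[OF i(1)] x
        by (auto elim: locally_constantE)
      have "t z = (if x \<in> C i then Some i else None)" if z: "z \<in> N \<inter> N'" for z
      proof (cases "x \<in> C i")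
        case True
        then show ?thesis using z N'(3)[of z] t_Some[OF i(1)] by simp
      next
        case False
        have "z \<notin> C k" if "k \<in> I" for k
        proof
          assume "z \<in> C k"
          then have "k = i" using z that i by (intro one[rule_format]) auto
          then show False using False \<open>z \<in> C k\<close> z N'(3) by blast
        qed
        then show ?thesis using False t_None by simp
      qed
      then have "t z = t x" if "z \<in> N \<inter> N'" for z
        using that N(2) N'(2) by simp
      then show ?thesis
        using N N' by (intro exI[of _ "N \<inter> N'"] conjI openin_Int) blast+
    qed
  qed
  then show ?thesis using t_Some by blast
qed

section \<open>Labellings of strongly zero-dimensional spaces\<close>

lemma strongly_zero_dimensional_clopen_between:
  fixes a b :: real
  assumes "strongly_zero_dimensional X" "continuous_map X euclideanreal g" "a < b"
  obtains U where "openin X U" "closedin X U" "{x \<in> topspace X. g x \<le> a} \<subseteq> U"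
    "U \<subseteq> {x \<in> topspace X. g x < b}"
proof -
  define c where "c = 1 / (b - a)"
  have c: "0 \<le> c" "(b - a) * c = 1" using assms(3) by (simp_all add: c_def)
  define h where "h x = max 0 (min 1 ((g x - a) * c))" for x
  have "continuous_map X euclideanreal h"
    unfolding h_def using assms(2) by (intro continuous_intros) auto
  then have "continuous_map X (top_of_set {0..1}) h"
    by (auto simp: continuous_map_in_subtopology h_def)
  moreover have "h x = 0" if "g x \<le> a" for x
  proof -
    have "(g x - a) * c \<le> 0" using that c(1) by (intro mult_nonpos_nonneg) auto
    then show ?thesis by (simp add: h_def)
  qed
  moreover have "h x = 1" if "b \<le> g x" for x
  proof -
    have "(b - a) * c \<le> (g x - a) * c" using that c(1) by (intro mult_right_mono) auto
    then show ?thesis using c(2) by (simp add: h_def)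
  qed
  ultimately have "completely_separated X {x \<in> topspace X. g x \<le> a} {x \<in> topspace X. b \<le> g x}"
    unfolding completely_separated_def by (intro exI[of _ h]) auto
  then obtain U where "openin X U" "closedin X U" "{x \<in> topspace X. g x \<le> a} \<subseteq> U"
    "U \<subseteq> topspace X - {x \<in> topspace X. b \<le> g x}"
    using assms(1) unfolding strongly_zero_dimensional_def by blast
  then show thesis by (intro that[of U]) auto
qed

lemma cozero_setD:
  assumes "cozero_set X U"
  shows "\<exists>u. continuous_map X euclideanreal u \<and> U = {x \<in> topspace X. 0 < (u x :: real)}"
proof -
  obtain Z where Z: "zero_set X Z" "U = topspace X - Z"
    using assms unfolding cozero_set_def by auto
  from zero_setD[OF Z(1)] obtain g where g: "continuous_map X euclideanreal g"
    and g0: "\<forall>x\<in>topspace X. 0 \<le> g x \<and> g x \<le> (1::real)" and Zg: "Z = {x \<in> topspace X. g x = 0}"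
    by auto
  have "U = {x \<in> topspace X. 0 < g x}"
    unfolding Z(2) Zg using g0 by (auto simp: order_less_le)
  then show ?thesis using g by (intro exI[of _ g] conjI)
qed

text \<open>The set \<open>A i\<close> need not be completely separated from the complement of its cozero neighbourhood
  \<open>U i = {u > 0}\<close>, so a single labelling may not suffice. However, \<open>U i\<close> is exhausted by the sets \<open>{u \<ge> 1 / (m + 1)}\<close>, and for each \<open>m\<close> such a set can
  be enclosed in a clopen subset of \<open>U i\<close>.\<close>

lemma sfd_family_labellings:
  assumes X: "strongly_zero_dimensional X" and A: "sfd_family X I A"
  shows "\<exists>t :: nat \<Rightarrow> 'a \<Rightarrow> 'i option. (\<forall>m. locally_constant X (t m))
    \<and> (\<forall>i\<in>I. \<forall>x\<in>A i. \<exists>m. t m x = Some i)"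
proof -
  obtain U where AX: "\<And>i. i \<in> I \<Longrightarrow> A i \<subseteq> topspace X" and disc: "discrete_family X I U"
    and U: "\<And>i. i \<in> I \<Longrightarrow> cozero_set X (U i) \<and> X closure_of A i \<subseteq> U i"
    using A unfolding sfd_family_def by blast
  have "\<exists>u. continuous_map X euclideanreal u \<and> U i = {x \<in> topspace X. 0 < (u x :: real)}"
    if "i \<in> I" for i
    using U[OF that] by (intro cozero_setD) simp
  then obtain u where u: "\<And>i. i \<in> I \<Longrightarrow> continuous_map X euclideanreal (u i)"
    "\<And>i. i \<in> I \<Longrightarrow> U i = {x \<in> topspace X. 0 < (u i x :: real)}"
    by metis
  have "\<exists>C. openin X C \<and> closedin X C \<and> {x \<in> topspace X. 1 / Suc m \<le> u i x} \<subseteq> C \<and> C \<subseteq> U i"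
    if "i \<in> I" for m i
  proof -
    have "continuous_map X euclideanreal (\<lambda>x. - u i x)"
      using u(1)[OF that] by (rule continuous_map_minus)
    moreover have "- (1 / Suc m) < (0::real)" by simp
    ultimately obtain C where "openin X C" "closedin X C"
      "{x \<in> topspace X. - u i x \<le> - (1 / Suc m)} \<subseteq> C" "C \<subseteq> {x \<in> topspace X. - u i x < 0}"
      by (rule strongly_zero_dimensional_clopen_between[OF X])
    then show ?thesis using u(2)[OF that] by auto
  qed
  then have "\<forall>m. \<forall>i\<in>I. \<exists>C. openin X C \<and> closedin X C
      \<and> {x \<in> topspace X. 1 / Suc m \<le> u i x} \<subseteq> C \<and> C \<subseteq> U i"
    by (intro allI ballI)
  then obtain C where *: "\<forall>m. \<forall>i\<in>I. openin X (C m i) \<and> closedin X (C m i)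
      \<and> {x \<in> topspace X. 1 / Suc m \<le> u i x} \<subseteq> C m i \<and> C m i \<subseteq> U i"
    unfolding bchoice_iff choice_iff by (elim exE)
  from * have clopen: "openin X (C m i) \<and> closedin X (C m i)" if "i \<in> I" for m i
    using that by simp
  from * have C: "{x \<in> topspace X. 1 / Suc m \<le> u i x} \<subseteq> C m i" if "i \<in> I" for m i
    using that by simp
  from * have CU: "C m i \<subseteq> U i" if "i \<in> I" for m i
    using that by simp
  have "discrete_family X I (C m)" for m
  proof -
    have "\<exists>N. openin X N \<and> x \<in> N \<and> (\<forall>i\<in>I. \<forall>j\<in>I. N \<inter> C m i \<noteq> {} \<and> N \<inter> C m j \<noteq> {} \<longrightarrow> i = j)"
      if x: "x \<in> topspace X" for x
    proof -
      have "\<exists>N. openin X N \<and> x \<in> N \<and> (\<forall>i\<in>I. \<forall>j\<in>I. N \<inter> U i \<noteq> {} \<and> N \<inter> U j \<noteq> {} \<longrightarrow> i = j)"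
        using disc x unfolding discrete_family_def by (elim conjE) (drule (1) bspec)
      then obtain N where N: "openin X N" "x \<in> N"
        and one: "\<forall>i\<in>I. \<forall>j\<in>I. N \<inter> U i \<noteq> {} \<and> N \<inter> U j \<noteq> {} \<longrightarrow> i = j"
        by (elim exE conjE)
      show ?thesis
      proof (intro exI[of _ N] conjI ballI impI N)
        fix i j assume "i \<in> I" "j \<in> I" "N \<inter> C m i \<noteq> {} \<and> N \<inter> C m j \<noteq> {}"
        then show "i = j"
          using CU[of i m] CU[of j m] by (intro one[rule_format]) auto
      qed
    qed
    moreover have "C m i \<subseteq> topspace X" if "i \<in> I" for i
      using clopen[OF that] openin_subset by blast
    ultimately show ?thesis unfolding discrete_family_def by blast
  qed
  then have "\<forall>m. \<exists>t :: 'a \<Rightarrow> 'i option. locally_constant X t \<and> (\<forall>i\<in>I. \<forall>x\<in>C m i. t x = Some i)"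
    by (intro allI discrete_clopen_family_labelling clopen)
  from choice[OF this] obtain t :: "nat \<Rightarrow> 'a \<Rightarrow> 'i option" where t: "\<And>m. locally_constant X (t m)"
    "\<And>m i x. \<lbrakk>i \<in> I; x \<in> C m i\<rbrakk> \<Longrightarrow> t m x = Some i"
    by auto
  have "\<exists>m. t m x = Some i" if i: "i \<in> I" "x \<in> A i" for i x
  proof -
    have "x \<in> X closure_of A i"
      using closure_of_subset[OF AX[OF i(1)]] i(2) by (rule subsetD)
    then have x: "x \<in> topspace X" "0 < u i x"
      using U[OF i(1)] u(2)[OF i(1)] by auto
    obtain m where "1 / Suc m < u i x"
      using x(2) by (rule nat_approx_posE)
    then have "x \<in> C m i" using C[OF i(1), of m] x(1) by auto
    then have "t m x = Some i" by (rule t(2)[OF i(1)])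
    then show ?thesis by (rule exI)
  qed
  with t(1) show ?thesis by (intro exI[of _ t] conjI allI ballI)
qed

section \<open>Approximation by locally constant mappings\<close>

context Metric_space
begin

text \<open>Members \<open>B\<close> of the base with small image are enclosed in the preimage of a ball, which
  is a union of zero sets \<open>Z B m\<close> as \<open>f\<close> belongs to K1. On \<open>Z B m\<close> the oscillation of \<open>f\<close> is
  small. For one sfd-family, a labelling \<open>t\<close> that guesses \<open>B\<close> lets one glue functions vanishing
  exactly on the sets \<open>Z B m\<close> into a single continuous function. The index runs over triples: the
  sfd-family, the labelling that is used for it, and the \<open>m\<close> of \<open>Z B m\<close>.\<close>

lemma K1_Sigma_f_determined_on_zero_sets:
  assumes X: "strongly_zero_dimensional X" and K: "f \<in> K1 X mtopology"
    and S: "f \<in> Sigma_f X mtopology" and "0 < e"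
  shows "\<exists>(t :: nat \<Rightarrow> 'x \<Rightarrow> 'x set option) (g :: nat \<Rightarrow> 'x \<Rightarrow> real).
    (\<forall>i. locally_constant X (t i)) \<and> (\<forall>i. continuous_map X euclideanreal (g i))
    \<and> (\<forall>i. \<forall>x\<in>topspace X. 0 \<le> g i x) \<and> (\<forall>x\<in>topspace X. \<exists>i. g i x = 0)
    \<and> (\<forall>i. \<forall>x\<in>topspace X. \<forall>z\<in>topspace X. g i x = 0 \<longrightarrow> g i z = 0 \<longrightarrow> t i x = t i z \<longrightarrow> d (f x) (f z) < e)"
proof -
  have f: "f \<in> topspace X \<rightarrow> M"
    and Fs: "\<And>V. openin mtopology V \<Longrightarrow> functionally_F_sigma X {x \<in> topspace X. f x \<in> V}"
    using K unfolding K1_def by auto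
  obtain \<A> :: "nat \<Rightarrow> 'x set set" where base: "base_for_map X mtopology f (\<Union>n. \<A> n)"
    and sfd: "\<And>n. sfd_family X (\<A> n) (\<lambda>S. S)"
    using S unfolding Sigma_f_def sigma_sfd_def by blast
  define pre where "pre y = {x \<in> topspace X. f x \<in> mball y (e / 2)}" for y
  have pre_small: "d (f x) (f z) < e" if "x \<in> pre y" "z \<in> pre y" for x z y
  proof -
    have M: "f x \<in> M" "f z \<in> M" "y \<in> M" "d y (f x) < e / 2" "d y (f z) < e / 2"
      using that by (auto simp: pre_def)
    then have "d (f x) (f z) \<le> d (f x) y + d y (f z)"
      by (intro triangle)
    then show ?thesis using M(4,5) commute[of y "f x"] by linarith
  qed
  define small where "small B \<longleftrightarrow> (\<exists>y. B \<subseteq> pre y)" for B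
  define centre where "centre B = (SOME y. B \<subseteq> pre y)" for B
  have centre: "B \<subseteq> pre (centre B)" if "small B" for B
    using that unfolding small_def centre_def by (rule someI_ex)
  have "functionally_F_sigma X (pre (centre B))" for B
    unfolding pre_def by (rule Fs) simp
  then obtain Z :: "'x set \<Rightarrow> nat \<Rightarrow> 'x set" where Z: "\<And>B m. zero_set X (Z B m)" and preZ: "\<And>B. pre (centre B) = (\<Union>m. Z B m)"
    unfolding functionally_F_sigma_def by metis
  have "\<forall>B m. \<exists>v. continuous_map X euclideanreal v \<and> (\<forall>x\<in>topspace X. 0 \<le> v x \<and> v x \<le> 1)
      \<and> Z B m = {x \<in> topspace X. v x = 0}"
    by (intro allI zero_setD Z)
  then obtain v :: "'x set \<Rightarrow> nat \<Rightarrow> 'x \<Rightarrow> real" where "\<forall>B m. continuous_map X euclideanreal (v B m)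
      \<and> (\<forall>x\<in>topspace X. 0 \<le> v B m x \<and> v B m x \<le> 1) \<and> Z B m = {x \<in> topspace X. v B m x = 0}"
    unfolding choice_iff by auto
  then have v: "\<And>B m. continuous_map X euclideanreal (v B m)"
    "\<And>B m x. x \<in> topspace X \<Longrightarrow> 0 \<le> v B m x \<and> v B m x \<le> 1"
    "\<And>B m. Z B m = {x \<in> topspace X. v B m x = 0}"
    by auto
  have "\<forall>n. \<exists>t. (\<forall>k. locally_constant X (t k)) \<and> (\<forall>B\<in>\<A> n. \<forall>x\<in>B. \<exists>k::nat. t k x = Some B)"
    by (intro allI sfd_family_labellings[OF X sfd])
  from choice[OF this] obtain T where *: "\<forall>n. (\<forall>k. locally_constant X (T n k))
      \<and> (\<forall>B\<in>\<A> n. \<forall>x\<in>B. \<exists>k::nat. T n k x = Some B)"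
    by (elim exE)
  then have T: "locally_constant X (T n k)" for n k
    by simp
  from * have T_Some: "\<exists>k. T n k x = Some B" if "B \<in> \<A> n" "x \<in> B" for n B x
    using that by simp
  \<comment> \<open>Where no member of the family is guessed, or one with a large image, the value \<open>1\<close> keeps
    the point out of the zero set.\<close>
  define G where "G m c = (case c of None \<Rightarrow> (\<lambda>x. 1) | Some B \<Rightarrow> if small B then v B m else (\<lambda>x. 1))"
    for m :: nat and c :: "'x set option"
  have contG: "continuous_map X euclideanreal (G m c)" for m c
    using v(1) by (auto simp: G_def split: option.split)
  have G0: "0 \<le> G m c x" if "x \<in> topspace X" for m c x
    using v(2)[OF that] by (auto simp: G_def split: option.split)
  define idx where "idx i = (fst (prod_decode i), prod_decode (snd (prod_decode i)))" for i
  define t where "t i = T (fst (idx i)) (fst (snd (idx i)))" for i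
  define g where "g i x = G (snd (snd (idx i))) (t i x) x" for i x
  have lc: "locally_constant X (t i)" for i
    unfolding t_def by (rule T)
  show ?thesis
  proof (intro exI[of _ t] exI[of _ g] conjI allI ballI impI)
    show "locally_constant X (t i)" for i by (rule lc)
    show "continuous_map X euclideanreal (g i)" for i
      unfolding g_def[abs_def] by (rule continuous_map_locally_constant_select[OF lc contG])
    show "0 \<le> g i x" if "x \<in> topspace X" for i x
      unfolding g_def using that by (rule G0)
  next
    fix x assume x: "x \<in> topspace X"
    then have "f x \<in> M" using f by blast
    then have xp: "x \<in> pre (f x)"
      using x \<open>0 < e\<close> by (simp add: pre_def)
    have "\<exists>\<U>\<subseteq>(\<Union>n. \<A> n). pre (f x) = \<Union>\<U>"
      using base openin_mball[of "f x" "e / 2"] unfolding base_for_map_def pre_def by blast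
    then obtain n B where B: "B \<in> \<A> n" "x \<in> B" "B \<subseteq> pre (f x)"
      using xp by blast
    then have "small B" by (auto simp: small_def)
    then obtain m where m: "x \<in> Z B m"
      using B(2) centre preZ by blast
    obtain k where k: "T n k x = Some B"
      using T_Some[OF B(1,2)] by blast
    have "g (prod_encode (n, prod_encode (k, m))) x = 0"
      using k m \<open>small B\<close> v(3) by (simp add: g_def t_def idx_def G_def)
    then show "\<exists>i. g i x = 0" by blast
  next
    fix i x z
    assume xz: "x \<in> topspace X" "z \<in> topspace X" and 0: "g i x = 0" "g i z = 0" and eq: "t i x = t i z"
    define m where "m = snd (snd (idx i))"
    obtain B where B: "t i x = Some B" "small B" "v B m x = 0"
      using 0(1) unfolding g_def G_def m_def[symmetric] by (auto split: option.splits if_splits)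
    moreover have "v B m z = 0"
      using 0(2) B eq unfolding g_def G_def m_def[symmetric] by auto
    ultimately have "x \<in> pre (centre B)" "z \<in> pre (centre B)"
      using xz v(3) preZ by auto
    then show "d (f x) (f z) < e" by (rule pre_small)
  qed
qed

text \<open>The zero sets \<open>{g i = 0}\<close> overlap. At stage \<open>m\<close>, only those points of \<open>{g i = 0}\<close> are kept
  at which the earlier functions are at least \<open>1 / (m + 1)\<close>. A clopen set \<open>W i m\<close> between
  \<open>{g i \<le> 0}\<close> and \<open>{g i < 1 / (m + 1)}\<close> then contains every point kept for \<open>i\<close> and no point
  kept for a later index. Therefore the least \<open>i\<close> with \<open>x \<in> W i m\<close>, which is locally constant in
  \<open>x\<close>, is for every kept point \<open>x\<close> the index for which it is kept.\<close>

lemma K1_Sigma_f_determined_eventually: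
  assumes X: "strongly_zero_dimensional X" and "f \<in> K1 X mtopology"
    and "f \<in> Sigma_f X mtopology" and "0 < e"
  shows "\<exists>(q :: nat \<Rightarrow> 'x \<Rightarrow> nat \<times> 'x set option) (H :: nat \<Rightarrow> 'x set).
    (\<forall>m. locally_constant X (q m)) \<and> (\<forall>x\<in>topspace X. \<forall>\<^sub>F m in sequentially. x \<in> H m)
    \<and> (\<forall>m x z. x \<in> H m \<longrightarrow> z \<in> H m \<longrightarrow> q m x = q m z \<longrightarrow> d (f x) (f z) < e)"
proof -
  from K1_Sigma_f_determined_on_zero_sets[OF assms]
  obtain t :: "nat \<Rightarrow> 'x \<Rightarrow> 'x set option" and g where
      *: "(\<forall>i. locally_constant X (t i)) \<and> (\<forall>i. continuous_map X euclideanreal (g i))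
    \<and> (\<forall>i. \<forall>x\<in>topspace X. 0 \<le> g i x) \<and> (\<forall>x\<in>topspace X. \<exists>i. g i x = 0)
    \<and> (\<forall>i. \<forall>x\<in>topspace X. \<forall>z\<in>topspace X. g i x = 0 \<longrightarrow> g i z = 0 \<longrightarrow> t i x = t i z \<longrightarrow> d (f x) (f z) < e)"
    by (elim exE)
  then have t: "locally_constant X (t i)" and g: "continuous_map X euclideanreal (g i)" for i
    by simp_all
  from * have g0: "0 \<le> g i x" if "x \<in> topspace X" for i x
    using that by simp
  from * have cover: "\<exists>i. g i x = 0" if "x \<in> topspace X" for x
    using that by simp
  from * have det: "d (f x) (f z) < e"
    if "x \<in> topspace X" "z \<in> topspace X" "g i x = 0" "g i z = 0" "t i x = t i z" for i x z
    using that by blast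
  have "\<forall>i m. \<exists>W. openin X W \<and> closedin X W \<and> {x \<in> topspace X. g i x \<le> 0} \<subseteq> W
      \<and> W \<subseteq> {x \<in> topspace X. g i x < 1 / Suc m}"
  proof (intro allI)
    fix i m
    have "0 < 1 / real (Suc m)" by simp
    with g[of i] obtain W where "openin X W" "closedin X W" "{x \<in> topspace X. g i x \<le> 0} \<subseteq> W"
      "W \<subseteq> {x \<in> topspace X. g i x < 1 / Suc m}"
      by (rule strongly_zero_dimensional_clopen_between[OF X])
    then show "\<exists>W. openin X W \<and> closedin X W \<and> {x \<in> topspace X. g i x \<le> 0} \<subseteq> W
      \<and> W \<subseteq> {x \<in> topspace X. g i x < 1 / Suc m}"
      by (intro exI[of _ W] conjI)
  qed
  then obtain W where *: "\<forall>i m. openin X (W i m) \<and> closedin X (W i m)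
      \<and> {x \<in> topspace X. g i x \<le> 0} \<subseteq> W i m \<and> W i m \<subseteq> {x \<in> topspace X. g i x < 1 / Suc m}"
    unfolding choice_iff by (elim exE)
  then have clopen: "openin X (W i m)" "closedin X (W i m)"
    and W: "{x \<in> topspace X. g i x \<le> 0} \<subseteq> W i m"
    and W': "W i m \<subseteq> {x \<in> topspace X. g i x < 1 / Suc m}" for i m
    by simp_all
  define j where "j m x = (LEAST i. x \<in> W i m)" for m x
  have j: "x \<in> W (j m x) m" if "x \<in> topspace X" for m x
  proof -
    obtain i where "g i x = 0" using cover[OF \<open>x \<in> topspace X\<close>] by blast
    then have "x \<in> W i m" using W that by force
    then show ?thesis unfolding j_def by (rule LeastI)
  qed
  have lcj: "locally_constant X (j m)" for m
    unfolding locally_constant_def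
  proof
    fix x assume x: "x \<in> topspace X"
    have "\<exists>N. openin X N \<and> x \<in> N \<and> (\<forall>z\<in>N. \<forall>i\<in>{..j m x}. (z \<in> W i m) = (x \<in> W i m))"
      by (intro locally_constant_finite_family locally_constant_mem_clopen clopen x finite_atMost)
    then obtain N where N: "openin X N" "x \<in> N"
      "\<forall>z\<in>N. \<forall>i\<in>{..j m x}. (z \<in> W i m) = (x \<in> W i m)"
      by (elim exE conjE)
    have "j m z = j m x" if z: "z \<in> N" for z
      unfolding j_def[of m z]
    proof (rule Least_equality)
      show "z \<in> W (j m x) m"
        using N(3) z j[OF x] by simp
      fix i assume i: "z \<in> W i m"
      show "j m x \<le> i"
      proof (rule ccontr)
        assume "\<not> j m x \<le> i"
        then have "x \<in> W i m" using N(3) z i by simp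
        then have "j m x \<le> i" unfolding j_def by (rule Least_le)
        then show False using \<open>\<not> j m x \<le> i\<close> by simp
      qed
    qed
    then show "\<exists>N. openin X N \<and> x \<in> N \<and> (\<forall>z\<in>N. j m z = j m x)"
      using N by blast
  qed
  define D where "D i m = {x \<in> topspace X. g i x = 0 \<and> (\<forall>i'<i. 1 / Suc m \<le> g i' x)}" for i m
  have jD: "j m x = i" if x: "x \<in> D i m" for i m x
    unfolding j_def
  proof (rule Least_equality)
    show "x \<in> W i m" using x W[of i m] by (auto simp: D_def)
    fix i' assume "x \<in> W i' m"
    then have "\<not> 1 / Suc m \<le> g i' x" using W'[of i' m] by auto
    moreover have "1 / Suc m \<le> g i' x" if "i' < i" using x that by (simp add: D_def)
    ultimately show "i \<le> i'" using not_le by blast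
  qed
  show ?thesis
  proof (intro exI[of _ "\<lambda>m x. (j m x, t (j m x) x)"] exI[of _ "\<lambda>m. \<Union>i. D i m"] conjI allI ballI impI)
    show "locally_constant X (\<lambda>x. (j m x, t (j m x) x))" for m
      by (rule locally_constant_select[OF lcj t])
    show "d (f x) (f z) < e"
      if mem: "x \<in> (\<Union>i. D i m)" "z \<in> (\<Union>i. D i m)" and eq: "(j m x, t (j m x) x) = (j m z, t (j m z) z)"
      for m x z
    proof -
      obtain i i' where i: "x \<in> D i m" "z \<in> D i' m" using mem by blast
      then have "i = i'" "t i x = t i z" using jD eq by auto
      then show ?thesis using i by (intro det) (auto simp: D_def)
    qed
    fix x assume x: "x \<in> topspace X"
    define i where "i = (LEAST i. g i x = 0)"
    have gi: "g i x = 0"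
      unfolding i_def using cover[OF x] by (rule LeastI_ex)
    have "\<forall>\<^sub>F m in sequentially. 1 / Suc m \<le> g i' x" if "i' < i" for i'
    proof -
      have "0 < g i' x"
        using not_less_Least[of i' "\<lambda>i. g i x = 0"] that g0[OF x, of i'] unfolding i_def by force
      then have "\<forall>\<^sub>F m in sequentially. 1 / Suc m < g i' x"
        using lim_inverse_n' LIMSEQ_Suc order_tendstoD(2) by blast
      then show ?thesis by (rule eventually_mono) simp
    qed
    then have "\<forall>\<^sub>F m in sequentially. \<forall>i'\<in>{..<i}. 1 / Suc m \<le> g i' x"
      by (intro eventually_ball_finite) auto
    then have "\<forall>\<^sub>F m in sequentially. x \<in> D i m"
      by (rule eventually_mono) (use x gi in \<open>auto simp: D_def\<close>)
    then show "\<forall>\<^sub>F m in sequentially. x \<in> (\<Union>i. D i m)"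
      by (rule eventually_mono) blast
  qed
qed

text \<open>The \<open>m\<close>-th approximation takes on each cell of the common refinement of the first \<open>m + 1\<close>
  partitions a single value \<open>f z\<close>. The point \<open>z\<close> is chosen in the cell so as to lie in
  \<open>H 0 m\<close>, \<open>H 1 m\<close>, ... for as long as possible: if \<open>k < m\<close> and some \<open>x\<close> in the cell lies in
  \<open>H 0 m, ..., H k m\<close>, then so does \<open>z\<close>, and therefore \<open>f z\<close> is within \<open>1 / (k + 1)\<close> of \<open>f x\<close>. One choice
  thus serves all degrees of precision simultaneously.\<close>

lemma K1_Sigma_f_subset_B1:
  assumes X: "strongly_zero_dimensional X"
  shows "K1 X mtopology \<inter> Sigma_f X mtopology \<subseteq> B1 X mtopology"
proof
  fix f assume "f \<in> K1 X mtopology \<inter> Sigma_f X mtopology"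
  then have KS: "f \<in> K1 X mtopology" "f \<in> Sigma_f X mtopology" by auto
  then have f: "f \<in> topspace X \<rightarrow> M" unfolding K1_def by auto
  have "\<forall>k. \<exists>(q :: nat \<Rightarrow> 'b \<Rightarrow> nat \<times> 'b set option) H. (\<forall>m. locally_constant X (q m))
      \<and> (\<forall>x\<in>topspace X. \<forall>\<^sub>F m in sequentially. x \<in> H m)
      \<and> (\<forall>m x z. x \<in> H m \<longrightarrow> z \<in> H m \<longrightarrow> q m x = q m z \<longrightarrow> d (f x) (f z) < 1 / Suc k)"
    by (intro allI K1_Sigma_f_determined_eventually X KS) simp
  then obtain q :: "nat \<Rightarrow> nat \<Rightarrow> 'b \<Rightarrow> nat \<times> 'b set option" and H where
      *: "\<forall>k. (\<forall>m. locally_constant X (q k m))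
      \<and> (\<forall>x\<in>topspace X. \<forall>\<^sub>F m in sequentially. x \<in> H k m)
      \<and> (\<forall>m x z. x \<in> H k m \<longrightarrow> z \<in> H k m \<longrightarrow> q k m x = q k m z \<longrightarrow> d (f x) (f z) < 1 / Suc k)"
    unfolding choice_iff by (elim exE)
  then have q: "locally_constant X (q k m)" for k m
    by simp
  from * have H: "\<forall>\<^sub>F m in sequentially. x \<in> H k m" if "x \<in> topspace X" for k x
    using that by simp
  from * have det: "d (f x) (f z) < 1 / Suc k"
    if "x \<in> H k m" "z \<in> H k m" "q k m x = q k m z" for k m x z
    using that by blast
  define cell where "cell m x = {z \<in> topspace X. \<forall>k\<le>m. q k m z = q k m x}" for m x
  \<comment> \<open>The number of consecutive sets \<open>H 0 m, H 1 m, ...\<close> that contain \<open>z\<close>, capped at \<open>m\<close> so that a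
    maximum over the cell is attained.\<close>
  define score where "score m z = (LEAST k. k = m \<or> z \<notin> H k m)" for m z
  have score_le: "score m z \<le> m" for m z
    unfolding score_def by (rule Least_le) simp
  have score_mem: "z \<in> H k m" if "k < score m z" for k m z
    using not_less_Least[of k "\<lambda>k. k = m \<or> z \<notin> H k m"] that unfolding score_def by blast
  have score_ge: "k < score m z" if "k < m" "\<And>k'. k' \<le> k \<Longrightarrow> z \<in> H k' m" for k m z
  proof -
    have "score m z = m \<or> z \<notin> H (score m z) m"
      unfolding score_def by (rule LeastI[of _ m]) simp
    then show ?thesis using that(1) that(2)[of "score m z"] by (cases "score m z \<le> k") auto
  qed
  define best where "best m x = arg_max (score m) (\<lambda>z. z \<in> cell m x)" for m x
  have best: "best m x \<in> cell m x \<and> (\<forall>z. z \<in> cell m x \<longrightarrow> score m z \<le> score m (best m x))"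
    if "x \<in> topspace X" for m x
  proof -
    have "x \<in> cell m x" using that by (simp add: cell_def)
    then show ?thesis
      unfolding best_def by (rule arg_max_nat_lemma[where b = "Suc m"]) (simp add: score_le less_Suc_eq_le)
  qed
  define F where "F m x = f (best m x)" for m x
  have "continuous_map X mtopology (F m)" for m
  proof (rule locally_constant_imp_continuous_map)
    show "F m \<in> topspace X \<rightarrow> topspace mtopology"
      using best f by (auto simp: F_def cell_def Pi_iff)
    show "locally_constant X (F m)"
      unfolding locally_constant_def
    proof
      fix x assume x: "x \<in> topspace X"
      have "\<exists>N. openin X N \<and> x \<in> N \<and> (\<forall>z\<in>N. \<forall>k\<in>{..m}. q k m z = q k m x)"
        by (intro locally_constant_finite_family q x finite_atMost)
      then obtain N where N: "openin X N" "x \<in> N" "\<forall>z\<in>N. \<forall>k\<in>{..m}. q k m z = q k m x"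
        by (elim exE conjE)
      have "F m z = F m x" if "z \<in> N" for z
      proof -
        have "cell m z = cell m x"
          using N(3) that by (auto simp: cell_def)
        then show ?thesis by (simp add: F_def best_def)
      qed
      then show "\<exists>N. openin X N \<and> x \<in> N \<and> (\<forall>z\<in>N. F m z = F m x)"
        using N by blast
    qed
  qed
  moreover have "limitin mtopology (\<lambda>m. F m x) (f x) sequentially" if x: "x \<in> topspace X" for x
    unfolding limitin_metric
  proof (intro conjI allI impI)
    show "f x \<in> M" using f x by blast
    fix e :: real assume "0 < e"
    then obtain k where k: "1 / Suc k < e" by (rule nat_approx_posE)
    have "\<forall>\<^sub>F m in sequentially. \<forall>k'\<in>{..k}. x \<in> H k' m"
      using H[OF x] by (intro eventually_ball_finite) auto
    then show "\<forall>\<^sub>F m in sequentially. F m x \<in> M \<and> d (F m x) (f x) < e"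
      using eventually_gt_at_top[of k]
    proof eventually_elim
      case (elim m)
      then have "k < score m x" by (intro score_ge) auto
      moreover have "score m x \<le> score m (best m x)"
        using best[OF x, of m] x by (simp add: cell_def)
      ultimately have "best m x \<in> H k m" by (intro score_mem) simp
      moreover have "x \<in> H k m" using elim by simp
      moreover have "q k m (best m x) = q k m x" "best m x \<in> topspace X"
        using best[OF x, of m] elim by (auto simp: cell_def)
      ultimately show ?case
        using det[of "best m x" k m x] k f by (auto simp: F_def)
    qed
  qed
  ultimately show "f \<in> B1 X mtopology"
    using f unfolding B1_def by auto
qed

end

section \<open>The characterization of Baire-one mappings\<close>

theorem theorem2p12:
  fixes X :: "'a topology" and Y :: "'b topology"
  assumes "strongly_zero_dimensional X"
    and "metrizable_space Y"
  shows "K1 X Y \<inter> Sigma_f X Y = B1 X Y"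
proof -
  obtain M d where "Metric_space M d" and Y: "Y = Metric_space.mtopology M d"
    using assms(2) unfolding metrizable_space_def by blast
  then interpret Metric_space M d by simp
  show ?thesis
    unfolding Y using K1_Sigma_f_subset_B1[OF assms(1)] B1_subset_K1 B1_subset_Sigma_f by blast
qed

end
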